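(* For every fixed integer $\ell\ge 3$ and every number of colors $q\ge 2$, there is a constant $c=O(q\log q)$ such that $$g(K^{\ell}_n;q)\le \mathrm{twr}_{\ell}(cn)$$ for all $n$.
   Context: A set of points in the plane is in general position if no three are collinear. A complete geometric $\ell$-hypergraph in the plane is a finite point set $V$ in general position in the plane with all $\ell$-element subsets of $V$ as edges. $g(K^{\ell}_n;q)$ is the minimum integer $N$ such that for every set of $N$ points in the plane in general position and every coloring of its $\ell$-element subsets with $q$ colors, there is a subset $S$ of $n$ points in convex position all of whose $\ell$-element subsets receive the same color. The tower function is defined by $\mathrm{twr}_1(x)=x$ and $\mathrm{twr}_{i+1}(x)=2^{\mathrm{twr}_i(x)}$. *)

theory Defs
  imports "HOL-Analysis.Analysis" "HOL-Library.Ramsey" "HOL-Library.Landau_Symbols"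
begin

definition general_position :: "(real^2) set \<Rightarrow> bool" where
  "general_position V \<longleftrightarrow> (\<forall>T \<in> nsets V 3. \<not> collinear T)"

definition convex_position :: "(real^2) set \<Rightarrow> bool" where
  "convex_position S \<longleftrightarrow> (\<forall>x\<in>S. x \<notin> convex hull (S - {x}))"

text \<open>
  The number \<open>N\<close> has the Ramsey property for \<open>l\<close>, \<open>n\<close>, \<open>q\<close>. The edges of the complete geometric
  \<open>l\<close>-hypergraph on \<open>V\<close> are the members of \<open>nsets V l\<close>; the colors are the numbers below \<open>q\<close>.
\<close>
definition geom_ramsey :: "nat \<Rightarrow> nat \<Rightarrow> nat \<Rightarrow> nat \<Rightarrow> bool" where
  "geom_ramsey l n q N \<longleftrightarrow>
     (\<forall>V col. finite V \<and> card V = N \<and> general_position V \<and> col \<in> nsets V l \<rightarrow> {..<q} \<longrightarrow>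
       (\<exists>S \<in> nsets V n. convex_position S \<and> (\<exists>i<q. \<forall>e \<in> nsets S l. col e = i)))"

text \<open>
  The infimum in \<^typ>\<open>enat\<close> is the minimum if some \<open>N\<close> has the Ramsey property and is
  \<open>\<infinity>\<close> otherwise, so a finite upper bound on it includes the existence of such an \<open>N\<close>.
\<close>
definition g_ramsey :: "nat \<Rightarrow> nat \<Rightarrow> nat \<Rightarrow> enat" where
  "g_ramsey l n q = Inf (enat ` {N. geom_ramsey l n q N})"

text \<open>Indexing starts at 1; the value at index 0 is a dummy.\<close>
fun twr :: "nat \<Rightarrow> real \<Rightarrow> real" where
  "twr 0 x = 0"
| "twr (Suc 0) x = x"
| "twr (Suc (Suc i)) x = 2 powr twr (Suc i) x"

end

theory Submission
  imports Defs
begin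

text \<open>
  Enumerate the points arbitrarily. A subset all of whose increasing triples have the same
  orientation is in convex position, so it suffices to apply a Ramsey theorem to \<open>2 q\<close> colors
  that record the given color of an edge and the orientation of its first three points. The
  Erdos-Rado argument bounds the Ramsey number for edges of size \<open>p + 2\<close> by
  \<open>(k ^ (R ^ p) + 1) ^ R\<close>, with \<open>R\<close> the number for edges of size \<open>p + 1\<close>. Starting from
  \<open>k * m\<close> for edges of size 1, each step adds one exponential, and only the first one contributes
  the factor \<open>k * log k\<close>.
\<close>

section \<open>A quantitative Ramsey theorem for hypergraphs\<close>

text \<open>The Erdos-Rado condition that the color of an edge does not depend on its largest
  element. \<open>W\<close> collects the points chosen so far and \<open>B\<close> is the reservoir
  for later ones; with \<open>B\<close> empty it is a condition on \<open>W\<close> alone.\<close>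

definition end_homogeneous :: "('a::linorder set \<Rightarrow> nat) \<Rightarrow> nat \<Rightarrow> 'a set \<Rightarrow> 'a set \<Rightarrow> bool" where
  "end_homogeneous f r W B \<longleftrightarrow>
     (\<forall>T\<in>nsets W r. \<forall>x\<in>W \<union> B. \<forall>y\<in>W \<union> B.
        (\<forall>t\<in>T. t < x \<and> t < y) \<longrightarrow> f (insert x T) = f (insert y T))"

text \<open>The minimum \<open>v\<close> of the reservoir joins \<open>W\<close>, and the other
  points are classified by the colors of the edges they form with \<open>v\<close> and
  \<open>p\<close> points of \<open>W\<close>. There are at most \<open>K\<close> classes, so one of
  them has at least \<open>M\<close> members and becomes the new reservoir; the strict inequality
  \<open>K * M < card B\<close> pays for the loss of \<open>v\<close>.\<close>

lemma end_homogeneous_step: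
  fixes f :: "'a::linorder set \<Rightarrow> nat"
  assumes fin: "finite W" "finite B" and "B \<noteq> {}"
    and below: "\<forall>w\<in>W. \<forall>b\<in>B. w < b"
    and eh: "end_homogeneous f (Suc p) W B"
    and f: "f \<in> nsets (W \<union> B) (Suc (Suc p)) \<rightarrow> {..<k}"
    and "k > 0" and K: "k ^ (card W choose p) \<le> K"
    and M: "K * M < card B"
  obtains v B' where "v \<in> B" "B' \<subseteq> B - {v}" "M \<le> card B'" "\<forall>b\<in>B'. v < b"
    "end_homogeneous f (Suc p) (insert v W) B'"
proof -
  define v where "v = Min B"
  have v: "v \<in> B" "\<And>b. b \<in> B \<Longrightarrow> v \<le> b"
    using fin \<open>B \<noteq> {}\<close> by (auto simp: v_def)
  have vW: "v \<notin> W"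
    using below v(1) by blast
  \<comment> \<open>The restricted lambda makes \<open>F x\<close> an element of the finite function
    space \<open>R\<close>, whose size bounds the number of classes.\<close>
  define F where "F = (\<lambda>x. \<lambda>T\<in>nsets W p. f (insert x (insert v T)))"
  define R where "R = PiE (nsets W p) (\<lambda>_. {..<k})"
  have finW: "finite (nsets W p)"
    using fin(1) by (simp add: finite_imp_finite_nsets)
  have FR: "F \<in> (B - {v}) \<rightarrow> R"
  proof
    fix x assume x: "x \<in> B - {v}"
    have "insert x (insert v T) \<in> nsets (W \<union> B) (Suc (Suc p))" if "T \<in> nsets W p" for T
    proof -
      have "x \<notin> W" using x below by blast
      then have "x \<notin> insert v T" "v \<notin> T"
        using that x vW by (auto simp: nsets_def)
      then show ?thesis
        using that x v(1) by (auto simp: nsets_def)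
    qed
    then show "F x \<in> R"
      using f unfolding F_def R_def by auto
  qed
  have finR: "finite R"
    unfolding R_def using finW by (intro finite_PiE) auto
  have "card R = k ^ (card W choose p)"
    unfolding R_def using finW by (simp add: card_PiE card_nsets)
  then have cR: "card R \<le> K" "R \<noteq> {}"
    using K \<open>k > 0\<close> by (auto simp: card_gt_0_iff)
  have "\<exists>y\<in>R. card (B - {v}) \<le> card (F -` {y} \<inter> (B - {v})) * card R"
    using FR finR fin(2) cR(2) by (intro pigeonhole_card) auto
  then obtain y where y: "card (B - {v}) \<le> card (F -` {y} \<inter> (B - {v})) * card R"
    by blast
  define B' where "B' = F -` {y} \<inter> (B - {v})"
  have "K * M \<le> card (B - {v})"
    using M v(1) fin(2) by simp
  also have "\<dots> \<le> card B' * card R"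
    using y by (simp add: B'_def)
  also have "\<dots> \<le> K * card B'"
    using cR(1) by simp
  finally have "K * M \<le> K * card B'" .
  moreover have "0 < K"
    using K \<open>k > 0\<close> by (metis order_less_le_trans zero_less_power)
  ultimately have MB: "M \<le> card B'"
    by simp
  have "end_homogeneous f (Suc p) (insert v W) B'"
    unfolding end_homogeneous_def
  proof (intro ballI impI)
    fix T x y'
    assume T: "T \<in> nsets (insert v W) (Suc p)" and x: "x \<in> insert v W \<union> B'"
      and y': "y' \<in> insert v W \<union> B'" and above: "\<forall>t\<in>T. t < x \<and> t < y'"
    show "f (insert x T) = f (insert y' T)"
    proof (cases "v \<in> T")
      case False
      then have "T \<in> nsets W (Suc p)"
        using T by (auto simp: nsets_def)
      moreover have "x \<in> W \<union> B" "y' \<in> W \<union> B"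
        using x y' v(1) by (auto simp: B'_def)
      ultimately show ?thesis
        using eh above unfolding end_homogeneous_def by blast
    next
      \<comment> \<open>Only sets \<open>T\<close> containing \<open>v\<close> are new. Points above
        \<open>v\<close> lie in \<open>B'\<close>, a single class of \<open>F\<close>, and the entry
        of \<open>F\<close> at \<open>T - {v}\<close> is the color in question.\<close>
      case True
      then have "v < x" "v < y'"
        using above by auto
      then have "x \<in> B'" "y' \<in> B'"
        using x y' below v(1) by force+
      then have "F x = F y'"
        by (simp add: B'_def)
      moreover have "T - {v} \<in> nsets W p"
        using T True by (auto simp: nsets_def)
      then have "F z (T - {v}) = f (insert z T)" for z
        using True by (simp add: F_def insert_absorb)
      ultimately show ?thesis
        by metis
    qed
  qed
  moreover have "B' \<subseteq> B - {v}"
    by (auto simp: B'_def)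
  moreover from this have "\<forall>b\<in>B'. v < b"
    using v(2) by (metis Diff_iff in_mono insertI1 order.not_eq_order_implies_strict)
  ultimately show ?thesis
    using v(1) MB that by simp
qed

text \<open>Iterates the step \<open>j\<close> times. Since \<open>W\<close> never outgrows
  \<open>t\<close>, each step meets at most \<open>k ^ (t ^ p)\<close> classes; the added 1 in the
  base covers the point that leaves the reservoir.\<close>

lemma end_homogeneous_extend:
  fixes f :: "'a::linorder set \<Rightarrow> nat"
  assumes "finite W" "finite B" "\<forall>w\<in>W. \<forall>b\<in>B. w < b"
    and "end_homogeneous f (Suc p) W B"
    and "f \<in> nsets (W \<union> B) (Suc (Suc p)) \<rightarrow> {..<k}"
    and "k > 0" "card W + j \<le> t"
    and "(k ^ (t ^ p) + 1) ^ j \<le> card B"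
  shows "\<exists>W'\<subseteq>W \<union> B. card W' = card W + j \<and> end_homogeneous f (Suc p) W' {}"
  using assms
proof (induction j arbitrary: W B)
  case 0
  then show ?case
    by (intro exI[of _ W]) (auto simp: end_homogeneous_def)
next
  case (Suc j)
  define K where "K = k ^ (t ^ p)"
  have "card W choose p \<le> card W ^ p"
    by (cases "p \<le> card W") (auto simp: binomial_le_pow binomial_eq_0)
  also have "\<dots> \<le> t ^ p"
    using Suc.prems(7) by (intro power_mono) auto
  finally have "card W choose p \<le> t ^ p" .
  then have K: "k ^ (card W choose p) \<le> K"
    using \<open>k > 0\<close> by (simp add: K_def power_increasing)
  have "K * (K + 1) ^ j < (K + 1) ^ Suc j"
    unfolding power_Suc by (intro mult_strict_right_mono) simp_all
  also have "\<dots> \<le> card B"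
    using Suc.prems(8) by (simp add: K_def)
  finally have M: "K * (K + 1) ^ j < card B" .
  then have "B \<noteq> {}"
    by auto
  obtain v B' where B': "v \<in> B" "B' \<subseteq> B - {v}" "(K + 1) ^ j \<le> card B'" "\<forall>b\<in>B'. v < b"
    "end_homogeneous f (Suc p) (insert v W) B'"
    using end_homogeneous_step[OF Suc.prems(1,2) \<open>B \<noteq> {}\<close> Suc.prems(3,4,5,6) K M] by blast
  have vW: "v \<notin> W"
    using B'(1) Suc.prems(3) by blast
  have "\<exists>W'\<subseteq>insert v W \<union> B'. card W' = card (insert v W) + j \<and> end_homogeneous f (Suc p) W' {}"
  proof (rule Suc.IH)
    show "finite B'"
      using B'(2) Suc.prems(2) by (meson finite_Diff finite_subset)
    show "\<forall>w\<in>insert v W. \<forall>b\<in>B'. w < b"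
      using B'(2,4) Suc.prems(3) by blast
    have "nsets (insert v W \<union> B') (Suc (Suc p)) \<subseteq> nsets (W \<union> B) (Suc (Suc p))"
      using B'(1,2) by (intro nsets_mono) auto
    then show "f \<in> nsets (insert v W \<union> B') (Suc (Suc p)) \<rightarrow> {..<k}"
      using Suc.prems(5) by blast
    show "card (insert v W) + j \<le> t"
      using Suc.prems(1,7) vW by simp
    show "(k ^ t ^ p + 1) ^ j \<le> card B'"
      using B'(3) by (simp add: K_def)
  qed (simp_all add: Suc.prems(1) B'(5) \<open>k > 0\<close>)
  moreover have "insert v W \<union> B' \<subseteq> W \<union> B"
    using B'(1,2) by auto
  moreover have "card (insert v W) + j = card W + Suc j"
    using Suc.prems(1) vW by simp
  ultimately show ?case
    by (metis order.trans)
qed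

text \<open>The index is shifted by one: \<open>ramsey_bound k m p\<close> is for edges of size \<open>p + 1\<close>.\<close>
fun ramsey_bound :: "nat \<Rightarrow> nat \<Rightarrow> nat \<Rightarrow> nat" where
  "ramsey_bound k m 0 = k * m"
| "ramsey_bound k m (Suc p) = (k ^ (ramsey_bound k m p ^ p) + 1) ^ ramsey_bound k m p"

text \<open>On an end-homogeneous set the color of an edge is determined by the edge without its
  maximum. This induces a coloring of sets smaller by one point, and a homogeneous set for it is
  homogeneous for \<open>f\<close>. The base case is the pigeonhole principle.\<close>

lemma hypergraph_ramsey:
  fixes A :: "'a::linorder set"
  assumes "finite A" "ramsey_bound k m p \<le> card A" "k > 0"
    and "f \<in> nsets A (Suc p) \<rightarrow> {..<k}"
  shows "\<exists>H\<in>nsets A m. \<exists>i<k. \<forall>e\<in>nsets H (Suc p). f e = i"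
  using assms
proof (induction p arbitrary: A f)
  case 0
  define g where "g = (\<lambda>x. f {x})"
  have "g \<in> A \<rightarrow> {..<k}"
    using 0 by (auto simp: g_def nsets_one)
  then have "\<exists>i\<in>{..<k}. card A \<le> card (g -` {i} \<inter> A) * card {..<k}"
    using 0 by (intro pigeonhole_card) auto
  then obtain i where i: "i < k" "card A \<le> card (g -` {i} \<inter> A) * k"
    by auto
  have "k * m \<le> k * card (g -` {i} \<inter> A)"
    using order.trans[OF "0.prems"(2) i(2)] by (simp add: mult.commute)
  then have "m \<le> card (g -` {i} \<inter> A)"
    using \<open>k > 0\<close> by simp
  then obtain H where H: "H \<subseteq> g -` {i} \<inter> A" "card H = m" "finite H"
    by (meson obtain_subset_with_card_n)
  then have "\<forall>e\<in>nsets H (Suc 0). f e = i"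
    by (auto simp: nsets_one g_def)
  moreover have "H \<in> nsets A m"
    using H by (auto simp: nsets_def)
  ultimately show ?case
    using i(1) by blast
next
  case (Suc p)
  let ?t = "ramsey_bound k m p"
  \<comment> \<open>The construction starts from the empty set, where the condition holds vacuously,
    with all of \<open>A\<close> as reservoir.\<close>
  have "\<exists>W\<subseteq>{} \<union> A. card W = card ({} :: 'a set) + ?t \<and> end_homogeneous f (Suc p) W {}"
    using Suc.prems
    by (intro end_homogeneous_extend[where t = ?t]) (auto simp: end_homogeneous_def nsets_def)
  then obtain W where W: "W \<subseteq> A" "card W = ?t" "end_homogeneous f (Suc p) W {}"
    by auto
  have finW: "finite W"
    using W(1) Suc.prems(1) by (rule finite_subset)
  define above where "above = (\<lambda>T x. x \<in> W \<and> (\<forall>t\<in>T. t < x))"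
  \<comment> \<open>By end-homogeneity the chosen point above \<open>T\<close> does not affect the
    color. The default 0 is for sets with no point of \<open>W\<close> above them; it is a legal
    color because \<open>k > 0\<close>.\<close>
  define g where "g = (\<lambda>T. if \<exists>x. above T x then f (insert (SOME x. above T x) T) else 0)"
  have g: "g T = f (insert x T)" if "T \<in> nsets W (Suc p)" "above T x" for T x
  proof -
    have "above T (SOME x. above T x)"
      using that(2) by (rule someI)
    then have "f (insert (SOME x. above T x) T) = f (insert x T)"
      using W(3) that unfolding end_homogeneous_def above_def by auto
    then show ?thesis
      using that(2) by (auto simp: g_def)
  qed
  have ins: "insert x T \<in> nsets W (Suc (Suc p))" if "T \<in> nsets W (Suc p)" "above T x" for T x
    using that unfolding nsets_def above_def by (auto simp: card_insert_if)
  have "g \<in> nsets W (Suc p) \<rightarrow> {..<k}"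
  proof
    fix T assume T: "T \<in> nsets W (Suc p)"
    show "g T \<in> {..<k}"
    proof (cases "\<exists>x. above T x")
      case True
      then obtain x where x: "above T x" by blast
      have "insert x T \<in> nsets A (Suc (Suc p))"
        using ins[OF T x] nsets_mono[OF W(1)] by blast
      then show ?thesis
        using g[OF T x] Suc.prems(4) by auto
    qed (use \<open>k > 0\<close> in \<open>auto simp: g_def\<close>)
  qed
  then obtain H i where H: "H \<in> nsets W m" "i < k" "\<forall>T\<in>nsets H (Suc p). g T = i"
    using Suc.IH[OF finW _ \<open>k > 0\<close>, of g] W(2) by fastforce
  have "f e = i" if e: "e \<in> nsets H (Suc (Suc p))" for e
  proof -
    have fe: "finite e" "e \<noteq> {}" "e \<subseteq> H" "card e = Suc (Suc p)"
      using e by (auto simp: nsets_def)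
    \<comment> \<open>With \<open>x\<close> the maximum, \<open>e\<close> extends
      \<open>e - {x}\<close> by a point above it, so \<open>f e\<close> is the induced color of
      \<open>e - {x}\<close>.\<close>
    define x where "x = Max e"
    have x: "x \<in> e" "\<And>y. y \<in> e \<Longrightarrow> y \<le> x"
      using fe by (auto simp: x_def)
    have T: "e - {x} \<in> nsets H (Suc p)"
      using fe x(1) by (auto simp: nsets_def)
    have "above (e - {x}) x"
      using x fe(3) H(1) by (auto simp: above_def nsets_def order.strict_iff_order)
    moreover have "e - {x} \<in> nsets W (Suc p)"
      using T H(1) nsets_mono[of H W] by (auto simp: nsets_def)
    ultimately have "g (e - {x}) = f e"
      using g x(1) by (metis insert_Diff)
    then show ?thesis
      using H(3) T by auto
  qed
  moreover have "H \<in> nsets A m"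
    using H(1) nsets_mono[OF W(1)] by blast
  ultimately show ?case
    using H(2) by blast
qed

section \<open>Orientation and convex position\<close>

text \<open>Twice the signed area of the triangle, positive exactly when \<open>a\<close>,
  \<open>b\<close>, \<open>c\<close> run counterclockwise.\<close>

definition orient :: "real^2 \<Rightarrow> real^2 \<Rightarrow> real^2 \<Rightarrow> real" where
  "orient a b c = (b$1 - a$1) * (c$2 - a$2) - (b$2 - a$2) * (c$1 - a$1)"

lemma orient_rotate: "orient b c a = orient a b c"
  by (simp add: orient_def algebra_simps)

lemma orient_same [simp]: "orient a b a = 0" "orient a b b = 0"
  by (simp_all add: orient_def algebra_simps)

lemma orient_affine:
  assumes "u + v = 1"
  shows "orient a b (u *\<^sub>R x + v *\<^sub>R y) = u * orient a b x + v * orient a b y"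
proof -
  have u: "u = 1 - v" using assms by simp
  show ?thesis by (simp add: u orient_def algebra_simps)
qed

text \<open>A vanishing determinant makes \<open>c - a\<close> a multiple of \<open>b - a\<close>
  when \<open>a\<close> and \<open>b\<close> differ; the factor is read off in a coordinate where
  they differ.\<close>

lemma collinear_if_orient_eq_0:
  assumes "orient a b c = 0"
  shows "collinear {a, b, c}"
proof (cases "a = b")
  case False
  then have ne: "b$1 \<noteq> a$1 \<or> b$2 \<noteq> a$2"
    by (auto simp: vec_eq_iff forall_2)
  have eq: "(b$1 - a$1) * (c$2 - a$2) = (b$2 - a$2) * (c$1 - a$1)"
    using assms by (simp add: orient_def)
  have "\<exists>s. c$1 = a$1 + s * (b$1 - a$1) \<and> c$2 = a$2 + s * (b$2 - a$2)"
  proof (cases "b$1 = a$1")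
    case True
    then show ?thesis
      using ne eq by (intro exI[of _ "(c$2 - a$2) / (b$2 - a$2)"]) simp
  next
    case False
    then show ?thesis
      using eq by (intro exI[of _ "(c$1 - a$1) / (b$1 - a$1)"]) (simp add: field_simps)
  qed
  then obtain s where "c$1 = a$1 + s * (b$1 - a$1)" "c$2 = a$2 + s * (b$2 - a$2)"
    by blast
  then have c: "c = (1 - s) *\<^sub>R a + s *\<^sub>R b"
    by (simp add: vec_eq_iff forall_2 algebra_simps)
  have "collinear {a, c, b}"
    unfolding collinear_3_expand by (intro disjI2 exI[of _ "1 - s"]) (simp add: c)
  then show ?thesis
    by (simp add: insert_commute)
qed (simp add: insert_absorb)

text \<open>Since \<open>orient a b\<close> vanishes at \<open>a\<close>, a combination with
  positive weight on a point of the set other than \<open>a\<close> stays strictly positive.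
  Including \<open>a\<close> lets the set hold the predecessor of a vertex together with all
  remaining points.\<close>

lemma convex_halfplane_insert:
  "convex {y. y = a \<or> s * orient a b y > 0}"
proof (rule convexI)
  fix x y u v
  assume x: "x \<in> {y. y = a \<or> s * orient a b y > 0}" and y: "y \<in> {y. y = a \<or> s * orient a b y > 0}"
    and uv: "0 \<le> u" "0 \<le> v" "u + v = (1::real)"
  define z where "z = u *\<^sub>R x + v *\<^sub>R y"
  have z: "s * orient a b z = u * (s * orient a b x) + v * (s * orient a b y)"
    using orient_affine[OF uv(3)] by (simp add: z_def algebra_simps)
  have "z = a \<or> s * orient a b z > 0"
  proof (cases "u = 0 \<or> v = 0")
    case True
    then show ?thesis
      using x y uv by (auto simp: z_def)
  next
    case False
    then have "u > 0" "v > 0"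
      using uv by auto
    moreover have "x = a \<and> y = a \<longrightarrow> z = a"
      using uv(3) by (simp add: z_def flip: scaleR_left_distrib)
    ultimately show ?thesis
      using x y unfolding z by (auto simp: add_pos_pos)
  qed
  then show "u *\<^sub>R x + v *\<^sub>R y \<in> {y. y = a \<or> s * orient a b y > 0}"
    by (simp add: z_def)
qed

text \<open>
  The enumeration \<open>h\<close> is arbitrary. The line through a point and its cyclic predecessor
  supports the point set.
\<close>
lemma convex_position_if_orient:
  fixes H :: "'a::linorder set" and h :: "'a \<Rightarrow> real^2"
  assumes fin: "finite H" and inj: "inj_on h H"
    and pos: "\<And>i j k. \<lbrakk>i \<in> H; j \<in> H; k \<in> H; i < j; j < k\<rbrakk> \<Longrightarrow> s * orient (h i) (h j) (h k) > 0"
  shows "convex_position (h ` H)"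
  unfolding convex_position_def
proof
  fix x assume "x \<in> h ` H"
  then obtain i where i: "i \<in> H" "x = h i" by blast
  show "x \<notin> convex hull (h ` H - {x})"
  proof (cases "H = {i}")
    case True
    then show ?thesis using i by simp
  next
    case False
    have "\<exists>p\<in>H. p \<noteq> i \<and> (\<forall>y\<in>H. y \<noteq> p \<and> y \<noteq> i \<longrightarrow> s * orient (h p) (h i) (h y) > 0)"
    proof (cases "\<exists>j\<in>H. j < i")
      case True
      define p where "p = Max {j\<in>H. j < i}"
      have "p \<in> {j\<in>H. j < i}"
        unfolding p_def using True fin by (intro Max_in) auto
      then have p: "p \<in> H" "p < i" by auto
      have "s * orient (h p) (h i) (h y) > 0" if y: "y \<in> H" "y \<noteq> p" "y \<noteq> i" for y
      proof (cases "y < i")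
        \<comment> \<open>By maximality of \<open>p\<close> the order is \<open>y\<close>,
          \<open>p\<close>, \<open>i\<close>, and a rotation brings \<open>p\<close> and
          \<open>i\<close> to the front.\<close>
        case True
        then have "y \<le> p"
          unfolding p_def using y fin by (intro Max_ge) auto
        then have "s * orient (h y) (h p) (h i) > 0"
          using y p i by (intro pos) auto
        then show ?thesis using orient_rotate[of "h p" "h i" "h y"] by simp
      next
        case False
        then show ?thesis using y p i by (intro pos) auto
      qed
      then show ?thesis using p by (intro bexI[of _ p]) auto
    next
      \<comment> \<open>For the minimum \<open>i\<close> the predecessor wraps around to the maximum
        of \<open>H\<close>. Every other \<open>y\<close> lies strictly between, and
        \<open>i\<close>, \<open>y\<close>, \<open>p\<close> rotates to \<open>p\<close>,
        \<open>i\<close>, \<open>y\<close>.\<close>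
      case no: False
      define p where "p = Max H"
      have p: "p \<in> H" "\<And>y. y \<in> H \<Longrightarrow> y \<le> p"
        unfolding p_def using i fin by (auto intro: Max_in)
      have "p \<noteq> i"
      proof
        assume "p = i"
        then have "y = i" if "y \<in> H" for y
          using p(2)[OF that] no that by force
        then show False using False i by blast
      qed
      moreover have "s * orient (h p) (h i) (h y) > 0" if y: "y \<in> H" "y \<noteq> p" "y \<noteq> i" for y
      proof -
        have "s * orient (h i) (h y) (h p) > 0"
          using y p i no by (intro pos) (auto simp: order.strict_iff_order not_less)
        then show ?thesis using orient_rotate[of "h i" "h y" "h p"] by simp
      qed
      ultimately show ?thesis using p(1) by blast
    qed
    then obtain p where p: "p \<in> H" "p \<noteq> i"
      "\<And>y. y \<in> H \<Longrightarrow> y \<noteq> p \<Longrightarrow> y \<noteq> i \<Longrightarrow> s * orient (h p) (h i) (h y) > 0"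
      by blast
    let ?C = "{y. y = h p \<or> s * orient (h p) (h i) y > 0}"
    have "h ` H - {x} \<subseteq> ?C"
      using p(3) i by auto
    then have "convex hull (h ` H - {x}) \<subseteq> ?C"
      using convex_halfplane_insert by (rule hull_minimal)
    \<comment> \<open>\<open>x\<close> lies on the bounding line, where \<open>orient\<close> is
      zero, and differs from \<open>h p\<close> by injectivity.\<close>
    moreover have "x \<notin> ?C"
      using p inj i by (auto dest: inj_onD)
    ultimately show ?thesis by blast
  qed
qed

section \<open>Transfer of the hypergraph Ramsey theorem to point sets\<close>

lemma split_initial:
  fixes H :: "'a::linorder set"
  assumes "finite H" "card H = n + d"
  shows "\<exists>X Y. H = X \<union> Y \<and> card X = n \<and> card Y = d \<and> (\<forall>x\<in>X. \<forall>y\<in>Y. x < y)"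
  using assms
proof (induction d arbitrary: H)
  case 0
  then show ?case by (intro exI[of _ H] exI[of _ "{}"]) auto
next
  case (Suc d)
  define z where "z = Max H"
  have "H \<noteq> {}" using Suc.prems by auto
  then have z: "z \<in> H" "\<And>x. x \<in> H \<Longrightarrow> x \<le> z"
    using Suc.prems by (auto simp: z_def)
  have "finite (H - {z})" "card (H - {z}) = n + d"
    using Suc.prems z(1) by auto
  from Suc.IH[OF this] obtain X Y where
    XY: "H - {z} = X \<union> Y" "card X = n" "card Y = d" "\<forall>x\<in>X. \<forall>y\<in>Y. x < y"
    by (elim exE conjE)
  have "finite (X \<union> Y)"
    using Suc.prems(1) by (simp flip: XY(1))
  then have "finite Y"
    by simp
  moreover have "z \<notin> X" "z \<notin> Y" "X \<subseteq> H"
    using XY(1) by auto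
  moreover have "x < z" if "x \<in> X" for x
    using z(2)[of x] that \<open>z \<notin> X\<close> \<open>X \<subseteq> H\<close> by (auto simp: order.strict_iff_order)
  moreover have "H = X \<union> insert z Y"
    using XY(1) z(1) by blast
  moreover have "card (insert z Y) = Suc d"
    using \<open>finite Y\<close> \<open>z \<notin> Y\<close> XY(3) by simp
  ultimately have "H = X \<union> insert z Y \<and> card X = n \<and> card (insert z Y) = Suc d \<and>
      (\<forall>x\<in>X. \<forall>y\<in>insert z Y. x < y)"
    using XY(2,4) by simp
  then show ?case
    by (intro exI)
qed

lemma general_position_orient:
  assumes "general_position V" "a \<in> V" "b \<in> V" "c \<in> V" "a \<noteq> b" "a \<noteq> c" "b \<noteq> c"
  shows "orient a b c \<noteq> 0"
proof
  assume "orient a b c = 0"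
  then have "collinear {a, b, c}"
    by (rule collinear_if_orient_eq_0)
  moreover have "{a, b, c} \<in> nsets V 3"
    using assms by (auto simp: nsets_def)
  ultimately show False
    using assms(1) by (auto simp: general_position_def)
qed

text \<open>
  Edges are coloured by their given color and by the orientation of their first three points.
  In a homogeneous set of \<open>n + d\<close> points every triple among the first \<open>n\<close> points starts the
  edge consisting of it and the last \<open>d\<close> points.
\<close>
lemma geom_ramsey_ramsey_bound:
  assumes "q > 0"
  shows "geom_ramsey (d + 3) n q (ramsey_bound (2 * q) (n + d) (d + 2))"
  unfolding geom_ramsey_def
proof (intro allI impI, elim conjE)
  fix V :: "(real^2) set" and col
  define N where "N = ramsey_bound (2 * q) (n + d) (d + 2)"
  assume "finite V" and cardV: "card V = ramsey_bound (2 * q) (n + d) (d + 2)"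
    and gp: "general_position V" and col: "col \<in> nsets V (d + 3) \<rightarrow> {..<q}"
  have "\<exists>h. bij_betw h {..<N} V"
    using \<open>finite V\<close> cardV by (intro finite_same_card_bij) (auto simp: N_def)
  then obtain h where h: "inj_on h {..<N}" "h ` {..<N} = V"
    by (auto simp: bij_betw_def)
  have him: "h ` e \<in> nsets (h ` X) r" if "e \<in> nsets X r" "X \<subseteq> {..<N}" for e X r
  proof -
    have "card (h ` e) = r"
      using that h(1) by (auto simp: nsets_def intro!: card_image inj_on_subset[OF h(1)])
    then show ?thesis using that by (auto simp: nsets_def)
  qed
  define first where "first = (\<lambda>e::nat set. \<lambda>i. h (sorted_list_of_set e ! i))"
  define ccw where "ccw = (\<lambda>e. orient (first e 0) (first e 1) (first e 2) > 0)"
  \<comment> \<open>The parity of \<open>f e\<close> stores the orientation, and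
    \<open>f e div 2\<close> is the given color.\<close>
  define f where "f = (\<lambda>e. 2 * col (h ` e) + of_bool (ccw e))"
  have "f \<in> nsets {..<N} (Suc (d + 2)) \<rightarrow> {..<2 * q}"
  proof
    fix e assume "e \<in> nsets {..<N} (Suc (d + 2))"
    then have "h ` e \<in> nsets V (d + 3)"
      using him[of e "{..<N}" "d + 3"] h(2) by (simp add: numeral_3_eq_3)
    then have "col (h ` e) < q" using col by auto
    then show "f e \<in> {..<2 * q}" by (auto simp: f_def of_bool_def)
  qed
  then have "\<exists>H\<in>nsets {..<N} (n + d). \<exists>i<2 * q. \<forall>e\<in>nsets H (Suc (d + 2)). f e = i"
    using \<open>q > 0\<close> by (intro hypergraph_ramsey) (auto simp: N_def)
  then obtain H i where H: "H \<subseteq> {..<N}" "finite H" "card H = n + d" "i < 2 * q"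
    and hom: "\<And>e. e \<in> nsets H (d + 3) \<Longrightarrow> f e = i"
    by (auto simp: nsets_def eval_nat_numeral)
  obtain X Y where XY: "H = X \<union> Y" "card X = n" "card Y = d" "\<And>x y. x \<in> X \<Longrightarrow> y \<in> Y \<Longrightarrow> x < y"
    using split_initial[OF H(2,3)] by blast
  have fin: "finite X" "finite Y" and XN: "X \<subseteq> {..<N}"
    using H(1,2) XY(1) by auto
  have injX: "inj_on h X"
    using h(1) XN by (rule inj_on_subset)
  define s :: real where "s = (if odd i then 1 else -1)"
  have "convex_position (h ` X)"
  proof (rule convex_position_if_orient[OF fin(1) injX, where s = s])
    fix a b c assume abc: "a \<in> X" "b \<in> X" "c \<in> X" "a < b" "b < c"
    \<comment> \<open>Padding by \<open>Y\<close> turns the triple into an edge; since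
      \<open>Y\<close> lies above \<open>X\<close>, its first three elements are \<open>a\<close>,
      \<open>b\<close>, \<open>c\<close>.\<close>
    define e where "e = {a, b, c} \<union> Y"
    have less: "a < y" "b < y" "c < y" if "y \<in> Y" for y
      using abc XY(4) that by auto
    have "a \<notin> Y" "b \<notin> Y" "c \<notin> Y"
      using less by blast+
    then have "e \<in> nsets H (d + 3)"
      using abc XY fin by (auto simp: nsets_def e_def)
    then have "f e = i" by (rule hom)
    then have ccw: "ccw e \<longleftrightarrow> odd i"
      by (auto simp: f_def)
    have "sorted_list_of_set (set (a # b # c # sorted_list_of_set Y)) = a # b # c # sorted_list_of_set Y"
      by (rule sorted_list_of_set.idem_if_sorted_distinct) (use abc fin less in force)+
    moreover have "set (a # b # c # sorted_list_of_set Y) = e"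
      using fin by (auto simp: e_def)
    ultimately have "sorted_list_of_set e = a # b # c # sorted_list_of_set Y"
      by (simp only:)
    then have "ccw e \<longleftrightarrow> orient (h a) (h b) (h c) > 0"
      by (simp add: ccw_def first_def numeral_2_eq_2)
    \<comment> \<open>Not counterclockwise now means strictly clockwise, as the sign
      \<open>s\<close> for even \<open>i\<close> requires.\<close>
    moreover have "orient (h a) (h b) (h c) \<noteq> 0"
    proof (rule general_position_orient[OF gp])
      show "h a \<in> V" "h b \<in> V" "h c \<in> V"
        using abc XN h(2) by auto
      show "h a \<noteq> h b" "h a \<noteq> h c" "h b \<noteq> h c"
        using abc by (simp_all add: inj_on_eq_iff[OF injX])
    qed
    ultimately show "s * orient (h a) (h b) (h c) > 0"
      using ccw by (auto simp: s_def)
  qed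
  moreover have "h ` X \<in> nsets V n"
    using him[of X X n] XN XY(2) fin(1) h(2) by (auto simp: nsets_def)
  moreover have "col e = i div 2" if e: "e \<in> nsets (h ` X) (d + 3)" for e
  proof -
    obtain e' where e': "e' \<subseteq> X" "e = h ` e'"
      using e by (auto simp: nsets_def subset_image_iff)
    then have "card e' = d + 3"
      using e injX by (metis (mono_tags, lifting) card_image inj_on_subset mem_Collect_eq nsets_def)
    then have "e' \<in> nsets H (d + 3)"
      using e' XY(1) fin(1) by (auto simp: nsets_def intro: finite_subset)
    then have "f e' = i" by (rule hom)
    then show ?thesis
      by (auto simp: f_def e'(2))
  qed
  moreover have "i div 2 < q"
    using H(4) by auto
  ultimately show "\<exists>S\<in>nsets V n. convex_position S \<and> (\<exists>i<q. \<forall>e\<in>nsets S (d + 3). col e = i)"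
    by blast
qed

section \<open>The tower bound\<close>

lemma le_two_powr: "(x::real) \<le> 2 powr x"
proof (cases "x \<ge> 0")
  case True
  have "x \<le> real (nat \<lfloor>x\<rfloor> + 1)"
    using True by linarith
  also have "nat \<lfloor>x\<rfloor> + 1 \<le> 2 ^ nat \<lfloor>x\<rfloor>"
    by (simp add: Suc_leI less_exp)
  then have "real (nat \<lfloor>x\<rfloor> + 1) \<le> 2 ^ nat \<lfloor>x\<rfloor>"
    by (metis of_nat_le_iff of_nat_numeral of_nat_power)
  also have "\<dots> = 2 powr real (nat \<lfloor>x\<rfloor>)"
    by (simp add: powr_realpow)
  also have "\<dots> \<le> 2 powr x"
    using True by (intro powr_mono) auto
  finally show ?thesis .
next
  case False
  then have "x \<le> 0" by simp
  also have "0 \<le> 2 powr x" by simp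
  finally show ?thesis .
qed

lemma twr_ge: "x \<le> twr (Suc i) x"
  by (induction i) (auto intro: order.trans[OF _ le_two_powr])

lemma twr_mono: "x \<le> y \<Longrightarrow> twr (Suc i) x \<le> twr (Suc i) y"
  by (induction i) auto

text \<open>Moves a constant factor into the argument without raising the tower: for
  \<open>t \<ge> 1\<close>, \<open>a \<le> 2 ^ (a - 1)\<close> gives
  \<open>a * 2 powr t \<le> 2 powr (a * t)\<close>, and this is applied level by level.\<close>

lemma mult_twr_le:
  assumes "a \<ge> 1" "x \<ge> 1"
  shows "real a * twr (Suc i) x \<le> twr (Suc i) (real a * x)"
proof (induction i)
  case (Suc i)
  let ?t = "twr (Suc i) x"
  have t: "?t \<ge> 1"
    using twr_ge[of x i] assms(2) by linarith
  have "a \<le> 2 ^ (a - 1)"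
    using assms(1) less_exp[of "a - 1"] by linarith
  then have "real a \<le> 2 ^ (a - 1)"
    by (metis of_nat_le_iff of_nat_numeral of_nat_power)
  also have "\<dots> = 2 powr real (a - 1)"
    by (simp add: powr_realpow)
  also have "real (a - 1) = real a - 1"
    using assms(1) by (simp add: of_nat_diff)
  also have "2 powr (real a - 1) \<le> 2 powr ((real a - 1) * ?t)"
    using t assms(1) mult_left_mono[of 1 ?t "real a - 1"] by (intro powr_mono) auto
  finally have "real a * 2 powr ?t \<le> 2 powr ((real a - 1) * ?t) * 2 powr ?t"
    by (intro mult_right_mono) auto
  also have "\<dots> = 2 powr (real a * ?t)"
    by (simp flip: powr_add add: algebra_simps)
  also have "\<dots> \<le> 2 powr twr (Suc i) (real a * x)"
    using Suc.IH by (intro powr_mono) auto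
  finally show ?case by simp
qed simp

text \<open>As \<open>k \<ge> 2\<close>, the added 1 costs at most one more factor \<open>k\<close>;
  the exponent is then at most twice a power of the previous bound, and \<open>log 2 k\<close>
  converts to base 2.\<close>

lemma ramsey_bound_Suc_le:
  assumes "k \<ge> 2"
  shows "real (ramsey_bound k m (Suc p)) \<le> 2 powr (2 * log 2 k * real (ramsey_bound k m p) ^ Suc p)"
proof -
  let ?R = "ramsey_bound k m p"
  have "k ^ (?R ^ p) \<ge> 1"
    using assms by simp
  then have "k ^ (?R ^ p) + 1 \<le> 2 * k ^ (?R ^ p)"
    by linarith
  also have "\<dots> \<le> k ^ Suc (?R ^ p)"
    using assms by simp
  finally have "ramsey_bound k m (Suc p) \<le> (k ^ Suc (?R ^ p)) ^ ?R"
    by (simp add: power_mono del: power_Suc)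
  also have "\<dots> = k ^ (Suc (?R ^ p) * ?R)"
    by (simp only: power_mult)
  also have "\<dots> \<le> k ^ (2 * ?R ^ Suc p)"
  proof (rule power_increasing)
    have "?R \<le> ?R ^ Suc p" by (cases "?R = 0") (auto intro!: self_le_power simp del: power_Suc)
    then show "Suc (?R ^ p) * ?R \<le> 2 * ?R ^ Suc p" by (simp add: mult.commute)
  qed (use assms in simp)
  finally have "real (ramsey_bound k m (Suc p)) \<le> real k ^ (2 * ?R ^ Suc p)"
    by (metis of_nat_le_iff of_nat_power)
  also have "\<dots> = (2 powr log 2 k) powr real (2 * ?R ^ Suc p)"
    using assms by (subst powr_realpow) auto
  also have "\<dots> = 2 powr (log 2 k * real (2 * ?R ^ Suc p))"
    by (simp only: powr_powr)
  finally show ?thesis by (simp add: mult_ac)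
qed

text \<open>The induction starts at edges of size 2, where the factor \<open>2 * log 2 k\<close>
  from the recursion is exactly what the argument contains. Each later step multiplies the argument
  by \<open>p + 3\<close>, which builds up the factorial.\<close>

lemma ramsey_bound_le_twr:
  assumes "k \<ge> 2" "m \<ge> 1"
  shows "real (ramsey_bound k m (Suc p))
       \<le> twr (Suc (Suc p)) (fact (p + 2) * (real k * real m * log 2 k))"
proof (induction p)
  case 0
  show ?case
    using ramsey_bound_Suc_le[OF assms(1), of m 0] by (simp add: mult_ac)
next
  case (Suc p)
  define L where "L = log 2 (real k)"
  define x where "x = real k * real m * L"
  define y where "y = fact (p + 2) * x"
  define t where "t = twr (Suc p) y"
  have L: "L \<ge> 1"
    using assms(1) by (simp add: L_def le_log_iff)
  have "2 * 1 \<le> real k * real m"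
    using assms by (intro mult_mono) auto
  then have x: "2 * L \<le> x"
    using L by (simp add: x_def)
  have "1 * x \<le> fact (p + 2) * x"
    using x L by (intro mult_right_mono) (auto simp del: fact_Suc intro: fact_ge_1)
  then have y: "2 * L \<le> y"
    using x by (simp add: y_def)
  have t: "y \<le> t"
    unfolding t_def by (rule twr_ge)
  let ?R = "ramsey_bound k m (Suc p)"
  \<comment> \<open>The induction hypothesis bounds \<open>?R\<close> by \<open>2 powr t\<close>.
    The factor \<open>2 * L\<close> is absorbed by one further \<open>2 powr t\<close>, so no new
    logarithm appears and the exponents add up to \<open>(p + 3) * t\<close>.\<close>
  have "2 * L * real ?R ^ Suc (Suc p) \<le> 2 powr t * (2 powr t) ^ Suc (Suc p)"
  proof (rule mult_mono)
    show "2 * L \<le> 2 powr t"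
      using y t le_two_powr[of t] by linarith
    show "real ?R ^ Suc (Suc p) \<le> (2 powr t) ^ Suc (Suc p)"
      using Suc.IH by (intro power_mono) (simp_all add: t_def y_def x_def L_def)
  qed (use L in auto)
  also have "\<dots> = (2 powr t) ^ (p + 3)"
    by (simp add: numeral_3_eq_3)
  also have "\<dots> = 2 powr (real (p + 3) * t)"
    by (simp add: powr_power mult.commute)
  also have "\<dots> \<le> 2 powr twr (Suc p) (real (p + 3) * y)"
    unfolding t_def using y L by (intro powr_mono mult_twr_le) auto
  also have "\<dots> = twr (Suc (Suc p)) (fact (Suc p + 2) * x)"
    by (simp add: y_def algebra_simps)
  finally have "2 powr (2 * L * real ?R ^ Suc (Suc p)) \<le> twr (Suc (Suc (Suc p))) (fact (Suc p + 2) * x)"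
    by simp
  then show ?case
    using ramsey_bound_Suc_le[OF assms(1), of m "Suc p"] unfolding x_def L_def by linarith
qed

text \<open>Handles \<open>n = 0\<close>, where the argument of the final tower is zero: the empty
  set has no edges of positive size.\<close>

lemma geom_ramsey_0: "q > 0 \<Longrightarrow> l > 0 \<Longrightarrow> geom_ramsey l 0 q 0"
  by (auto simp: geom_ramsey_def nsets_def convex_position_def)

lemma g_ramsey_le:
  assumes "geom_ramsey l n q N" "real N \<le> b"
  shows "ereal_of_enat (g_ramsey l n q) \<le> ereal b"
proof -
  have "g_ramsey l n q \<le> enat N"
    unfolding g_ramsey_def using assms(1) by (intro Inf_lower) auto
  then have "ereal_of_enat (g_ramsey l n q) \<le> ereal_of_enat (enat N)"
    by (simp only: ereal_of_enat_le_iff)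
  also have "\<dots> \<le> ereal b"
    using assms(2) by simp
  finally show ?thesis .
qed

theorem theorem2:
  fixes l :: nat
  assumes "l \<ge> 3"
  shows "\<exists>c :: nat \<Rightarrow> real. c \<in> O(\<lambda>q. real q * ln (real q)) \<and>
           (\<forall>q\<ge>2. \<forall>n. ereal_of_enat (g_ramsey l n q) \<le> ereal (twr l (c q * real n)))"
proof -
  obtain d where l: "l = d + 3"
    using assms by (metis add.commute le_Suc_ex)
  \<comment> \<open>The factorial comes from the tower bound. The 4 pays for \<open>2 * q\<close>
    colors and for \<open>log 2 (2 * q) \<le> 2 * log 2 q\<close>, and \<open>d + 1\<close> for
    \<open>n + d \<le> (d + 1) * n\<close> with \<open>n \<ge> 1\<close>.\<close>
  define C :: real where "C = 4 * fact l * real (d + 1)"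
  define c where "c = (\<lambda>q::nat. C * (real q * log 2 (real q)))"
  have "c = (\<lambda>q. C / ln 2 * (real q * ln (real q)))"
    by (simp add: c_def log_def)
  then have "c \<in> O(\<lambda>q. real q * ln (real q))"
    by simp
  moreover have "ereal_of_enat (g_ramsey l n q) \<le> ereal (twr l (c q * real n))" if q: "q \<ge> 2" for q n
  proof (cases "n = 0")
    case True
    have "0 \<le> twr l (c q * real n)"
      using twr_ge[of 0 "d + 2"] by (simp add: True l eval_nat_numeral)
    then show ?thesis
      using True q assms by (intro g_ramsey_le[OF geom_ramsey_0[of q l, folded True]]) auto
  next
    case False
    have "log 2 (real (2 * q)) \<le> 2 * log 2 (real q)"
      using q by (simp add: log_mult le_log_iff)
    moreover have "real (n + d) \<le> real (d + 1) * real n"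
      using False by (cases n) (auto simp: algebra_simps)
    ultimately have "(real (2 * q) * real (n + d)) * log 2 (real (2 * q))
        \<le> (real (2 * q) * (real (d + 1) * real n)) * (2 * log 2 (real q))"
      using q by (intro mult_mono) auto
    then have "fact l * (real (2 * q) * real (n + d) * log 2 (real (2 * q)))
        \<le> fact l * ((real (2 * q) * (real (d + 1) * real n)) * (2 * log 2 (real q)))"
      by (intro mult_left_mono) auto
    also have "\<dots> = c q * real n"
      by (simp add: c_def C_def)
    finally have le: "fact l * (real (2 * q) * real (n + d) * log 2 (real (2 * q))) \<le> c q * real n" .
    have "real (ramsey_bound (2 * q) (n + d) (Suc (d + 1)))
        \<le> twr (Suc (Suc (d + 1))) (fact (d + 1 + 2) * (real (2 * q) * real (n + d) * log 2 (real (2 * q))))"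
      using q False by (intro ramsey_bound_le_twr) auto
    also have "d + 1 + 2 = l" by (simp add: l)
    also have "twr (Suc (Suc (d + 1))) (fact l * (real (2 * q) * real (n + d) * log 2 (real (2 * q))))
        \<le> twr (Suc (Suc (d + 1))) (c q * real n)"
      using le by (rule twr_mono)
    also have "Suc (Suc (d + 1)) = l" by (simp add: l)
    finally have "real (ramsey_bound (2 * q) (n + d) (d + 2)) \<le> twr l (c q * real n)"
      by simp
    then show ?thesis
      using geom_ramsey_ramsey_bound[of q d n] q by (intro g_ramsey_le) (auto simp: l)
  qed
  ultimately show ?thesis by blast
qed

end
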